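(* Consider the filtering problem with filtering density $p(x,t)$ and a particle system $$dS_t=u(S_t,t)\,dt+k(S_t,t)\,dY_t+v(S_t,t)\,dB_t,\qquad dW_t=W_t\big(\gamma(S_t,t)\,dt+\varepsilon(S_t,t)\,dY_t+\zeta(S_t,t)\,dB_t\big),$$ under assumptions (i)--(v) listed in the context, and assume that $$\frac{\partial}{\partial x}(kp)+(h-\hat h_t-\varepsilon)\,p=0.$$ Then a particular solution to $$\frac12\frac{\partial^2}{\partial x^2}\big((k^2+v^2-g^2)p\big)-\frac{\partial}{\partial x}\big((u+k\varepsilon+v\zeta-f)p\big)+\big((h-\hat h_t)\hat h_t+\gamma\big)p=0$$ is given by the following class: $$\varepsilon=\eta(h-\hat h_t)+\tilde\varepsilon,$$ $$\gamma=-(\alpha+\eta-\alpha\eta)(h-\hat h_t)\hat h_t-(1-\alpha)\tilde\varepsilon\,\hat h_t,$$ $$v^2=g^2-\beta k^2,$$ $$u=f-\tfrac12k\Big(\vartheta_1h+\vartheta_2\hat h_t+(1+\beta)\tilde\varepsilon-(1-\beta)\frac{\partial k}{\partial x}\Big)-v\zeta,$$ where $\tilde\varepsilon\in C^{1,0}$ is an arbitrary function with zero mean under the filtering distribution, $\int_{\mathbb{R}}\tilde\varepsilon(x,t)p(x,t)\,dx=0$, such that $\varepsilon$ meets the requirements of assumption (i); $\alpha,\beta,\eta$ are free real parameters, either constant or continuously time-varying (not depending on $x$); and $$\vartheta_1:=1-\beta+\eta+\beta\eta,\qquad\vartheta_2:=1+\beta-\eta-\beta\eta-2\alpha.$$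
   Context: All processes are real-valued, defined on a filtered probability space satisfying the usual conditions, and progressively measurable; SDEs are in the Itô sense. Filtering problem: $dX_t=f(X_t,t)\,dt+g(X_t,t)\,dB^X_t$ with $X_0\sim P_0$, and $dY_t=h(X_t,t)\,dt+dB^Y_t$ with $Y_0=0$, where $B^X,B^Y$ are independent real Brownian motions, $f,g,h:\mathbb{R}\times\mathbb{R}_{\ge0}\to\mathbb{R}$ are known functions, and $X_0$ is independent of $(B^X,B^Y)$ with distribution $P_0$ having finite second moment. $\mathcal{F}^Y_t:=\sigma(Y_s:0\le s\le t)$. The filtering distribution $P_t$ is the regular conditional distribution of $X_t$ given $\mathcal{F}^Y_t$; $p(x,t)$ is its density with respect to Lebesgue measure, with $p(\cdot,0)=p_0\in C^2$; it satisfies the Kushner--Stratonovich equation $dp=\mathcal{L}_t^\dagger p\,dt+p(h-\hat h_t)(dY_t-\hat h_t\,dt)$, $\mathcal{L}^\dagger_t\,\cdot=-\frac{\partial}{\partial x}(f\,\cdot)+\frac12\frac{\partial^2}{\partial x^2}(g^2\,\cdot)$. $\hat h_t:=\mathbb{E}[h(X_t,t)|\mathcal{F}^Y_t]=\int h(x,t)p(x,t)\,dx$. Standing assumptions: $f,g$ satisfy the conditions for well-posedness of the SDE (e.g. locally Lipschitz in $x$ uniformly in $t$); and either $g^2\ge\delta>0$ for a constant $\delta$ with $f\in C_b^{1,0}$, $g^2\in C_b^{2,0}$, $h\in C_b^{1,0}$ ($C_b^{\kappa,j}$: bounded continuous functions with bounded partial derivatives up to order $\kappa$ in $x$ and $j$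 in $t$), or the linear-Gaussian case $f=ax$, $g=b$, $h=cx$ with $a,b,c\in\mathbb{R}$ and $P_0$ Gaussian. Assumptions: (i) regularity conditions ensuring well-posedness of the SDEs for $(S_t,W_t)$ together with those for $(X_t,Y_t)$ hold; (ii) $S_0\sim P_0$ and $W_0=1$; (iii) $B_t$ is a Brownian motion independent of $\{(B^X_t)_{t\ge0},(B^Y_t)_{t\ge0},X_0,S_0\}$; (iv) $u\in C^{1,0}$ and $k,v\in C^{2,0}$; (v) $\gamma,\varepsilon,\zeta\in C^{1,0}$. Here $C^{\kappa,j}$ denotes functions of $(x,t)$ with continuous partial derivatives up to order $\kappa$ in $x$ and $j$ in $t$. The coefficients may depend on the filtering distribution. *)

theory Defs
  imports "HOL-Probability.Probability"
begin

section \<open>Functions of space and time\<close>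

text \<open>
  The class \<open>C\<^sup>\<kappa>\<^sup>,\<^sup>0\<close> on \<open>\<real> \<times> \<real>\<^sub>\<ge>\<^sub>0\<close>. Functions of \<open>(x, t)\<close> are total on \<^typ>\<open>real\<close>; only their values
  at \<open>t \<ge> 0\<close> matter here and below.
\<close>

definition C_x :: "nat \<Rightarrow> (real \<Rightarrow> real \<Rightarrow> real) \<Rightarrow> bool" where
  "C_x \<kappa> \<phi> \<longleftrightarrow>
     (\<forall>i<\<kappa>. \<forall>t\<ge>0. \<forall>x. ((deriv ^^ i) (\<lambda>y. \<phi> y t)) differentiable (at x)) \<and>
     (\<forall>i\<le>\<kappa>. continuous_on (UNIV \<times> {0..}) (\<lambda>(x, t). (deriv ^^ i) (\<lambda>y. \<phi> y t) x))"

definition Cb_x :: "nat \<Rightarrow> (real \<Rightarrow> real \<Rightarrow> real) \<Rightarrow> bool" where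
  "Cb_x \<kappa> \<phi> \<longleftrightarrow> C_x \<kappa> \<phi> \<and>
     (\<forall>i\<le>\<kappa>. \<exists>K. \<forall>t\<ge>0. \<forall>x. \<bar>(deriv ^^ i) (\<lambda>y. \<phi> y t) x\<bar> \<le> K)"

section \<open>Processes on a filtered probability space\<close>

text \<open>
  Processes are written \<open>Z t \<omega>\<close>, random fields \<open>\<phi> \<omega> x t\<close>. The filtration is only used at
  nonnegative times.
\<close>

definition progressive :: "(real \<Rightarrow> 'a measure) \<Rightarrow> (real \<Rightarrow> 'a \<Rightarrow> real) \<Rightarrow> bool" where
  "progressive F H \<longleftrightarrow>
     (\<forall>T\<ge>0. (\<lambda>(t, \<omega>). H t \<omega>) \<in> borel_measurable (restrict_space borel {0..T} \<Otimes>\<^sub>M F T))"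

definition progressive_field ::
    "(real \<Rightarrow> 'a measure) \<Rightarrow> ('a \<Rightarrow> real \<Rightarrow> real \<Rightarrow> real) \<Rightarrow> bool" where
  "progressive_field F \<phi> \<longleftrightarrow>
     (\<forall>T\<ge>0. (\<lambda>((t, \<omega>), x). \<phi> \<omega> x t)
        \<in> borel_measurable ((restrict_space borel {0..T} \<Otimes>\<^sub>M F T) \<Otimes>\<^sub>M borel))"

definition natural_filtration :: "'a measure \<Rightarrow> (real \<Rightarrow> 'a \<Rightarrow> real) \<Rightarrow> real \<Rightarrow> 'a measure" where
  "natural_filtration M Y t =
     sigma (space M) {Y s -` A \<inter> space M | s A. 0 \<le> s \<and> s \<le> t \<and> A \<in> sets borel}"

definition completed_filtration :: "'a measure \<Rightarrow> (real \<Rightarrow> 'a measure) \<Rightarrow> real \<Rightarrow> 'a measure" where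
  "completed_filtration M G t = sigma (space M) (sets (G t) \<union> null_sets M)"

definition sample_path :: "(real \<Rightarrow> 'a \<Rightarrow> real) \<Rightarrow> 'a \<Rightarrow> real \<Rightarrow> real" where
  "sample_path Z \<omega> = (\<lambda>t\<in>{0..}. Z t \<omega>)"

abbreviation path_space :: "(real \<Rightarrow> real) measure" where
  "path_space \<equiv> PiM {0..} (\<lambda>_. borel)"

locale usual_conditions = prob_space M for M :: "'a measure" +
  fixes F :: "real \<Rightarrow> 'a measure"
  assumes subalgebra_F: "\<And>t. 0 \<le> t \<Longrightarrow> subalgebra M (F t)"
    and mono_F: "\<And>s t. 0 \<le> s \<Longrightarrow> s \<le> t \<Longrightarrow> sets (F s) \<subseteq> sets (F t)"
    and right_continuous_F: "\<And>t. 0 \<le> t \<Longrightarrow> sets (F t) = (\<Inter>s\<in>{t<..}. sets (F s))"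
    and complete_F: "\<And>N A. N \<in> null_sets M \<Longrightarrow> A \<subseteq> N \<Longrightarrow> A \<in> sets (F 0)"
begin

definition continuous_process :: "(real \<Rightarrow> 'a \<Rightarrow> real) \<Rightarrow> bool" where
  "continuous_process Z \<longleftrightarrow>
     progressive F Z \<and> (AE \<omega> in M. continuous_on {0..} (\<lambda>t. Z t \<omega>))"

definition independent ::
    "'b measure \<Rightarrow> ('a \<Rightarrow> 'b) \<Rightarrow> 'c measure \<Rightarrow> ('a \<Rightarrow> 'c) \<Rightarrow> bool" where
  "independent N Z N' Z' \<longleftrightarrow>
     random_variable N Z \<and> random_variable N' Z' \<and>
     indep_set (sets (vimage_algebra (space M) Z N)) (sets (vimage_algebra (space M) Z' N'))"

text \<open>
  Brownian motion is relative to the filtration \<open>F\<close>; \<^term>\<open>independent (F s) (\<lambda>\<omega>. \<omega>)\<close> is independence of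
  the \<open>\<sigma>\<close>-algebra \<open>F s\<close>.
\<close>

definition brownian_motion :: "(real \<Rightarrow> 'a \<Rightarrow> real) \<Rightarrow> bool" where
  "brownian_motion B \<longleftrightarrow>
     continuous_process B \<and>
     (AE \<omega> in M. B 0 \<omega> = 0) \<and>
     (\<forall>s\<ge>0. \<forall>t>s.
        distributed M lborel (\<lambda>\<omega>. B t \<omega> - B s \<omega>) (normal_density 0 (sqrt (t - s))) \<and>
        independent (F s) (\<lambda>\<omega>. \<omega>) borel (\<lambda>\<omega>. B t \<omega> - B s \<omega>))"

subsection \<open>Stochastic integrals\<close>

text \<open>
  A simple process is \<open>\<Sum>i<n. \<xi>\<^sub>i 1\<^bsub>(\<tau>\<^sub>i, \<tau>\<^sub>i\<^sub>+\<^sub>1]\<^esub>\<close> with deterministic times and bounded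
  \<open>\<F>\<^bsub>\<tau>\<^sub>i\<^esub>\<close>-measurable \<open>\<xi>\<^sub>i\<close>.
\<close>

definition simple_data :: "nat \<Rightarrow> (nat \<Rightarrow> real) \<Rightarrow> (nat \<Rightarrow> 'a \<Rightarrow> real) \<Rightarrow> bool" where
  "simple_data n \<tau> \<xi> \<longleftrightarrow>
     0 \<le> \<tau> 0 \<and>
     (\<forall>i<n. \<tau> i \<le> \<tau> (Suc i) \<and> \<xi> i \<in> borel_measurable (F (\<tau> i)) \<and>
        (\<exists>K. \<forall>\<omega>\<in>space M. \<bar>\<xi> i \<omega>\<bar> \<le> K))"

definition simple_process ::
    "nat \<Rightarrow> (nat \<Rightarrow> real) \<Rightarrow> (nat \<Rightarrow> 'a \<Rightarrow> real) \<Rightarrow> real \<Rightarrow> 'a \<Rightarrow> real" where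
  "simple_process n \<tau> \<xi> t \<omega> = (\<Sum>i<n. \<xi> i \<omega> * indicator {\<tau> i<..\<tau> (Suc i)} t)"

definition simple_integral ::
    "(real \<Rightarrow> 'a \<Rightarrow> real) \<Rightarrow> nat \<Rightarrow> (nat \<Rightarrow> real) \<Rightarrow> (nat \<Rightarrow> 'a \<Rightarrow> real) \<Rightarrow> real \<Rightarrow> 'a \<Rightarrow> real" where
  "simple_integral B n \<tau> \<xi> t \<omega> =
     (\<Sum>i<n. \<xi> i \<omega> * (B (min (\<tau> (Suc i)) t) \<omega> - B (min (\<tau> i) t) \<omega>))"

text \<open>
  \<open>J\<close> is a version of the Ito integral process \<open>\<integral>H dB\<close>, for progressive \<open>H\<close> with
  \<open>\<integral>\<^sub>0\<^sup>T H\<^sup>2 ds < \<infinity>\<close> almost surely: the continuous limit in probability of integrals of simple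
  processes that converge to \<open>H\<close> in \<open>L\<^sup>2[0,T]\<close> in probability. Limits at each fixed time determine
  \<open>J\<close> up to indistinguishability because its paths are continuous.
\<close>

definition ito_integral ::
    "(real \<Rightarrow> 'a \<Rightarrow> real) \<Rightarrow> (real \<Rightarrow> 'a \<Rightarrow> real) \<Rightarrow> (real \<Rightarrow> 'a \<Rightarrow> real) \<Rightarrow> bool" where
  "ito_integral B H J \<longleftrightarrow>
     progressive F H \<and>
     (AE \<omega> in M. \<forall>T\<ge>0. set_integrable lborel {0..T} (\<lambda>s. (H s \<omega>)\<^sup>2)) \<and>
     continuous_process J \<and>
     (\<exists>n \<tau> \<xi>. (\<forall>m. simple_data (n m) (\<tau> m) (\<xi> m)) \<and>
        (\<forall>T\<ge>0. \<forall>e>0.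
           (\<lambda>m. prob {\<omega>\<in>space M. ennreal e <
              (\<integral>\<^sup>+ s\<in>{0..T}. ennreal ((simple_process (n m) (\<tau> m) (\<xi> m) s \<omega> - H s \<omega>)\<^sup>2) \<partial>lborel)})
             \<longlonglongrightarrow> 0 \<and>
           (\<lambda>m. prob {\<omega>\<in>space M. e <
              \<bar>simple_integral B (n m) (\<tau> m) (\<xi> m) T \<omega> - J T \<omega>\<bar>})
             \<longlonglongrightarrow> 0))"

definition drift_integrable :: "(real \<Rightarrow> 'a \<Rightarrow> real) \<Rightarrow> bool" where
  "drift_integrable a \<longleftrightarrow>
     progressive F a \<and> (AE \<omega> in M. \<forall>T\<ge>0. set_integrable lborel {0..T} (\<lambda>s. a s \<omega>))"

text \<open>\<open>I = \<integral>H dZ\<close> for the semimartingale \<open>dZ = b dt + dB\<close>.\<close>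

definition semimartingale_integral ::
    "(real \<Rightarrow> 'a \<Rightarrow> real) \<Rightarrow> (real \<Rightarrow> 'a \<Rightarrow> real) \<Rightarrow> (real \<Rightarrow> 'a \<Rightarrow> real) \<Rightarrow>
     (real \<Rightarrow> 'a \<Rightarrow> real) \<Rightarrow> bool" where
  "semimartingale_integral b B H I \<longleftrightarrow>
     drift_integrable (\<lambda>s \<omega>. H s \<omega> * b s \<omega>) \<and>
     (\<exists>J. ito_integral B H J \<and>
        (AE \<omega> in M. \<forall>t\<ge>0. I t \<omega> = (LBINT s:{0..t}. H s \<omega> * b s \<omega>) + J t \<omega>))"

subsection \<open>The stochastic differential equations\<close>

definition signal_SDE ::
    "(real \<Rightarrow> real \<Rightarrow> real) \<Rightarrow> (real \<Rightarrow> real \<Rightarrow> real) \<Rightarrow> (real \<Rightarrow> 'a \<Rightarrow> real) \<Rightarrow>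
     (real \<Rightarrow> 'a \<Rightarrow> real) \<Rightarrow> bool" where
  "signal_SDE f g BX X \<longleftrightarrow>
     continuous_process X \<and>
     drift_integrable (\<lambda>s \<omega>. f (X s \<omega>) s) \<and>
     (\<exists>I. ito_integral BX (\<lambda>s \<omega>. g (X s \<omega>) s) I \<and>
        (AE \<omega> in M. \<forall>t\<ge>0. X t \<omega> = X 0 \<omega> + (LBINT s:{0..t}. f (X s \<omega>) s) + I t \<omega>))"

definition observation_SDE ::
    "(real \<Rightarrow> real \<Rightarrow> real) \<Rightarrow> (real \<Rightarrow> 'a \<Rightarrow> real) \<Rightarrow> (real \<Rightarrow> 'a \<Rightarrow> real) \<Rightarrow>
     (real \<Rightarrow> 'a \<Rightarrow> real) \<Rightarrow> bool" where
  "observation_SDE h BY X Y \<longleftrightarrow>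
     continuous_process Y \<and>
     drift_integrable (\<lambda>s \<omega>. h (X s \<omega>) s) \<and>
     (AE \<omega> in M. \<forall>t\<ge>0. Y t \<omega> = (LBINT s:{0..t}. h (X s \<omega>) s) + BY t \<omega>)"

text \<open>
  In the particle equations \<open>dY\<close> is \<open>h(X\<^sub>t,t) dt + dB\<^sup>Y\<close>, so \<open>h\<close>, \<open>X\<close> and \<open>B\<^sup>Y\<close> appear instead of \<open>Y\<close>.
\<close>

definition particle_SDE ::
    "('a \<Rightarrow> real \<Rightarrow> real \<Rightarrow> real) \<Rightarrow> ('a \<Rightarrow> real \<Rightarrow> real \<Rightarrow> real) \<Rightarrow> ('a \<Rightarrow> real \<Rightarrow> real \<Rightarrow> real) \<Rightarrow>
     (real \<Rightarrow> real \<Rightarrow> real) \<Rightarrow> (real \<Rightarrow> 'a \<Rightarrow> real) \<Rightarrow> (real \<Rightarrow> 'a \<Rightarrow> real) \<Rightarrow>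
     (real \<Rightarrow> 'a \<Rightarrow> real) \<Rightarrow> (real \<Rightarrow> 'a \<Rightarrow> real) \<Rightarrow> bool" where
  "particle_SDE u k v h BY B X S \<longleftrightarrow>
     continuous_process S \<and>
     drift_integrable (\<lambda>s \<omega>. u \<omega> (S s \<omega>) s) \<and>
     (\<exists>I J. semimartingale_integral (\<lambda>s \<omega>. h (X s \<omega>) s) BY (\<lambda>s \<omega>. k \<omega> (S s \<omega>) s) I \<and>
        ito_integral B (\<lambda>s \<omega>. v \<omega> (S s \<omega>) s) J \<and>
        (AE \<omega> in M. \<forall>t\<ge>0.
           S t \<omega> = S 0 \<omega> + (LBINT s:{0..t}. u \<omega> (S s \<omega>) s) + I t \<omega> + J t \<omega>))"

definition weight_SDE ::
    "('a \<Rightarrow> real \<Rightarrow> real \<Rightarrow> real) \<Rightarrow> ('a \<Rightarrow> real \<Rightarrow> real \<Rightarrow> real) \<Rightarrow> ('a \<Rightarrow> real \<Rightarrow> real \<Rightarrow> real) \<Rightarrow>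
     (real \<Rightarrow> real \<Rightarrow> real) \<Rightarrow> (real \<Rightarrow> 'a \<Rightarrow> real) \<Rightarrow> (real \<Rightarrow> 'a \<Rightarrow> real) \<Rightarrow>
     (real \<Rightarrow> 'a \<Rightarrow> real) \<Rightarrow> (real \<Rightarrow> 'a \<Rightarrow> real) \<Rightarrow> (real \<Rightarrow> 'a \<Rightarrow> real) \<Rightarrow> bool" where
  "weight_SDE \<gamma> \<epsilon> \<zeta> h BY B X S W \<longleftrightarrow>
     continuous_process W \<and>
     drift_integrable (\<lambda>s \<omega>. W s \<omega> * \<gamma> \<omega> (S s \<omega>) s) \<and>
     (\<exists>I J. semimartingale_integral (\<lambda>s \<omega>. h (X s \<omega>) s) BY (\<lambda>s \<omega>. W s \<omega> * \<epsilon> \<omega> (S s \<omega>) s) I \<and>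
        ito_integral B (\<lambda>s \<omega>. W s \<omega> * \<zeta> \<omega> (S s \<omega>) s) J \<and>
        (AE \<omega> in M. \<forall>t\<ge>0.
           W t \<omega> = W 0 \<omega> + (LBINT s:{0..t}. W s \<omega> * \<gamma> \<omega> (S s \<omega>) s) + I t \<omega> + J t \<omega>))"

subsection \<open>Well-posedness\<close>

text \<open>
  Well-posedness is existence of a solution with the given initial data, driven by the given Brownian
  motions, together with pathwise uniqueness. The random coefficient fields of the particle
  equations are held fixed.
\<close>

definition indistinguishable :: "(real \<Rightarrow> 'a \<Rightarrow> real) \<Rightarrow> (real \<Rightarrow> 'a \<Rightarrow> real) \<Rightarrow> bool" where
  "indistinguishable Z Z' \<longleftrightarrow> (AE \<omega> in M. \<forall>t\<ge>0. Z t \<omega> = Z' t \<omega>)"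

definition signal_well_posed ::
    "(real \<Rightarrow> real \<Rightarrow> real) \<Rightarrow> (real \<Rightarrow> real \<Rightarrow> real) \<Rightarrow> (real \<Rightarrow> 'a \<Rightarrow> real) \<Rightarrow>
     (real \<Rightarrow> 'a \<Rightarrow> real) \<Rightarrow> bool" where
  "signal_well_posed f g BX X \<longleftrightarrow>
     signal_SDE f g BX X \<and>
     (\<forall>X'. signal_SDE f g BX X' \<and> (AE \<omega> in M. X' 0 \<omega> = X 0 \<omega>) \<longrightarrow> indistinguishable X' X)"

definition joint_SDE where
  "joint_SDE f g h u k v \<gamma> \<epsilon> \<zeta> BX BY B X Y S W \<longleftrightarrow>
     signal_SDE f g BX X \<and> observation_SDE h BY X Y \<and>
     particle_SDE u k v h BY B X S \<and> weight_SDE \<gamma> \<epsilon> \<zeta> h BY B X S W"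

definition joint_well_posed where
  "joint_well_posed f g h u k v \<gamma> \<epsilon> \<zeta> BX BY B X Y S W \<longleftrightarrow>
     joint_SDE f g h u k v \<gamma> \<epsilon> \<zeta> BX BY B X Y S W \<and>
     (\<forall>X' Y' S' W'.
        joint_SDE f g h u k v \<gamma> \<epsilon> \<zeta> BX BY B X' Y' S' W' \<and>
        (AE \<omega> in M. X' 0 \<omega> = X 0 \<omega> \<and> S' 0 \<omega> = S 0 \<omega> \<and> W' 0 \<omega> = W 0 \<omega>) \<longrightarrow>
        indistinguishable X' X \<and> indistinguishable Y' Y \<and>
        indistinguishable S' S \<and> indistinguishable W' W)"

end

section \<open>The filtering problem\<close>

definition standing_conditions ::
    "(real \<Rightarrow> real \<Rightarrow> real) \<Rightarrow> (real \<Rightarrow> real \<Rightarrow> real) \<Rightarrow> (real \<Rightarrow> real \<Rightarrow> real) \<Rightarrow> real measure \<Rightarrow> bool" where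
  "standing_conditions f g h P0 \<longleftrightarrow>
     ((\<exists>\<delta>>0. \<forall>t\<ge>0. \<forall>x. \<delta> \<le> (g x t)\<^sup>2) \<and>
        Cb_x 1 f \<and> Cb_x 2 (\<lambda>x t. (g x t)\<^sup>2) \<and> Cb_x 1 h) \<or>
     (\<exists>a b c. \<forall>t\<ge>0. \<forall>x. f x t = a * x \<and> g x t = b \<and> h x t = c * x) \<and>
        (\<exists>m \<sigma>. 0 < \<sigma> \<and> P0 = density lborel (\<lambda>x. ennreal (normal_density m \<sigma> x)))"

text \<open>The filter mean \<open>\<integral>h(x,t) p(x,t) dx\<close>, as a process.\<close>

definition filter_mean ::
    "(real \<Rightarrow> real \<Rightarrow> real) \<Rightarrow> ('a \<Rightarrow> real \<Rightarrow> real \<Rightarrow> real) \<Rightarrow> real \<Rightarrow> 'a \<Rightarrow> real" where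
  "filter_mean h p t \<omega> = (LINT x|lborel. h x t * p \<omega> x t)"

definition kolmogorov_forward ::
    "(real \<Rightarrow> real \<Rightarrow> real) \<Rightarrow> (real \<Rightarrow> real \<Rightarrow> real) \<Rightarrow> (real \<Rightarrow> real \<Rightarrow> real) \<Rightarrow> real \<Rightarrow> real \<Rightarrow> real" where
  "kolmogorov_forward f g q x t =
     - deriv (\<lambda>y. f y t * q y t) x + 1/2 * deriv (deriv (\<lambda>y. (g y t)\<^sup>2 * q y t)) x"

text \<open>
  \<open>P t \<omega>\<close> is the regular conditional distribution of \<open>X\<^sub>t\<close> given \<open>\<F>\<^sup>Y\<^sub>t\<close>. Its density \<open>p \<omega> x t\<close> is
  adapted to the completion of \<open>\<F>\<^sup>Y\<close>, since conditional distributions are only determined almost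
  surely for each \<open>t\<close>. The Kushner--Stratonovich equation holds in the classical sense in \<open>x\<close>; its
  noise is \<open>dY - \<hat>h dt = (h(X\<^sub>t,t) - \<hat>h\<^sub>t) dt + dB\<^sup>Y\<close>.
\<close>

locale filtering_problem = usual_conditions M F
  for M :: "'a measure" and F :: "real \<Rightarrow> 'a measure" +
  fixes f g h :: "real \<Rightarrow> real \<Rightarrow> real"
    and P0 :: "real measure" and p0 :: "real \<Rightarrow> real"
    and BX BY X Y :: "real \<Rightarrow> 'a \<Rightarrow> real"
    and P :: "real \<Rightarrow> 'a \<Rightarrow> real measure"
    and p :: "'a \<Rightarrow> real \<Rightarrow> real \<Rightarrow> real"
  assumes BX: "brownian_motion BX"
    and BY: "brownian_motion BY"
    and indep_BX_BY: "independent path_space (sample_path BX) path_space (sample_path BY)"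
    and X0_distr: "distr M borel (X 0) = P0"
    and X0_second_moment: "integrable P0 (\<lambda>x. x\<^sup>2)"
    and indep_X0: "independent borel (X 0)
      (path_space \<Otimes>\<^sub>M path_space) (\<lambda>\<omega>. (sample_path BX \<omega>, sample_path BY \<omega>))"
    and signal: "signal_well_posed f g BX X"
    and observation: "observation_SDE h BY X Y"
    and standing: "standing_conditions f g h P0"
    and P_kernel: "\<And>t. 0 \<le> t \<Longrightarrow> P t \<in> natural_filtration M Y t \<rightarrow>\<^sub>M prob_algebra borel"
    and P_conditional: "\<And>t A. 0 \<le> t \<Longrightarrow> A \<in> sets borel \<Longrightarrow>
      AE \<omega> in M. measure (P t \<omega>) A =
        real_cond_exp M (natural_filtration M Y t) (\<lambda>\<omega>. indicator A (X t \<omega>)) \<omega>"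
    and p_progressive: "progressive_field (completed_filtration M (natural_filtration M Y)) p"
    and p_nonneg: "AE \<omega> in M. \<forall>t\<ge>0. \<forall>x. 0 \<le> p \<omega> x t"
    and p_density: "\<And>t. 0 \<le> t \<Longrightarrow>
      AE \<omega> in M. P t \<omega> = density lborel (\<lambda>x. ennreal (p \<omega> x t))"
    and p0_C2: "C_x 2 (\<lambda>x t. p0 x)"
    and p_initial: "AE \<omega> in M. \<forall>x. p \<omega> x 0 = p0 x"
    and p_regular: "AE \<omega> in M. \<forall>t\<ge>0. \<forall>x.
      (\<lambda>y. f y t * p \<omega> y t) differentiable (at x) \<and>
      (\<lambda>y. (g y t)\<^sup>2 * p \<omega> y t) differentiable (at x) \<and>
      deriv (\<lambda>y. (g y t)\<^sup>2 * p \<omega> y t) differentiable (at x)"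
    and kushner_stratonovich: "\<And>x.
      drift_integrable (\<lambda>s \<omega>. kolmogorov_forward f g (p \<omega>) x s) \<and>
      (\<exists>I. semimartingale_integral (\<lambda>s \<omega>. h (X s \<omega>) s - filter_mean h p s \<omega>) BY
             (\<lambda>s \<omega>. p \<omega> x s * (h x s - filter_mean h p s \<omega>)) I \<and>
        (AE \<omega> in M. \<forall>t\<ge>0.
           p \<omega> x t = p0 x + (LBINT s:{0..t}. kolmogorov_forward f g (p \<omega>) x s) + I t \<omega>))"

text \<open>
  Coefficients that may depend on the filtering distribution are random fields adapted to the
  completed observation filtration, with the stated smoothness in \<open>(x, t)\<close> for almost every outcome.
\<close>

definition observable_C_x ::
    "'a measure \<Rightarrow> (real \<Rightarrow> 'a \<Rightarrow> real) \<Rightarrow> nat \<Rightarrow> ('a \<Rightarrow> real \<Rightarrow> real \<Rightarrow> real) \<Rightarrow> bool" where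
  "observable_C_x M Y \<kappa> \<phi> \<longleftrightarrow>
     progressive_field (completed_filtration M (natural_filtration M Y)) \<phi> \<and>
     (AE \<omega> in M. C_x \<kappa> (\<phi> \<omega>))"

locale particle_system = filtering_problem M F f g h P0 p0 BX BY X Y P p
  for M :: "'a measure" and F f g h P0 p0 BX BY X Y P p +
  fixes B S W :: "real \<Rightarrow> 'a \<Rightarrow> real"
    and u k v \<gamma> \<epsilon> \<zeta> :: "'a \<Rightarrow> real \<Rightarrow> real \<Rightarrow> real"
  assumes well_posed: "joint_well_posed f g h u k v \<gamma> \<epsilon> \<zeta> BX BY B X Y S W"
    and S0_distr: "distr M borel (S 0) = P0"
    and W0: "AE \<omega> in M. W 0 \<omega> = 1"
    and B: "brownian_motion B"
    and indep_B: "independent path_space (sample_path B)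
      (path_space \<Otimes>\<^sub>M path_space \<Otimes>\<^sub>M borel \<Otimes>\<^sub>M borel)
      (\<lambda>\<omega>. (sample_path BX \<omega>, sample_path BY \<omega>, X 0 \<omega>, S 0 \<omega>))"
    and u_regular: "observable_C_x M Y 1 u"
    and k_regular: "observable_C_x M Y 2 k"
    and v_regular: "observable_C_x M Y 2 v"
    and \<gamma>_regular: "observable_C_x M Y 1 \<gamma>"
    and \<epsilon>_regular: "observable_C_x M Y 1 \<epsilon>"
    and \<zeta>_regular: "observable_C_x M Y 1 \<zeta>"

end

theory Submission
  imports Defs
begin

text \<open>
  Almost surely, at each time, this is an identity between functions of \<open>x\<close>. The constraint
  \<open>(k p)' = - (h - \<hat>h - \<epsilon>) p\<close> serves two purposes.

  The relation between \<open>v\<close>, \<open>g\<close> and \<open>k\<close> turns the second-order coefficient into \<open>(1 - \<beta>) k\<^sup>2\<close>, so that the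
  function to be differentiated twice is \<open>(1 - \<beta>) k\<close> times the flux \<open>k p\<close>. By the constraint, its first
  derivative is again a multiple of the flux, namely \<open>(1 - \<beta>) (k' - (h - \<hat>h - \<epsilon>)) k p\<close>
  (\<open>deriv_scaled_square_flux\<close>). Every step keeps \<open>k\<close> and \<open>p\<close> together in this way, since where \<open>k\<close>
  vanishes the constraint gives no control of \<open>p'\<close>.

  The first-order term is \<open>k p\<close> times an expression in \<open>h\<close>, \<open>\<hat>h\<close>, \<open>\<epsilon>\<close> and \<open>k'\<close> as well. The parameters
  \<open>\<theta>\<^sub>1\<close>, \<open>\<theta>\<^sub>2\<close> are chosen so that half the derivative above minus the first-order term loses every
  dependence on \<open>k'\<close>, \<open>h\<close> and \<open>\<epsilon>\<close>, leaving \<open>(1 - \<alpha>) \<hat>h k p\<close> (\<open>flux_balance\<close>). The constraint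
  differentiates this remainder once more, to \<open>- (1 - \<alpha>) \<hat>h (h - \<hat>h - \<epsilon>) p\<close>, and \<open>\<gamma>\<close> is exactly the
  reaction rate for which the zeroth-order term cancels it.
\<close>

text \<open>
  The function \<open>h\<close> occurs in the first derivative of \<open>(1 - \<beta>) k\<^sup>2 p\<close>, which must be differentiated once
  more; the bounded and the linear-Gaussian alternative each supply its derivative.
\<close>

lemma standing_conditions_h_differentiable:
  assumes "standing_conditions f g h P0" and "0 \<le> t"
  shows "(\<lambda>y. h y t) differentiable (at x)"
  using assms(1) unfolding standing_conditions_def
proof (elim disjE conjE exE)
  assume "Cb_x 1 h"
  then show ?thesis
    using \<open>0 \<le> t\<close> by (auto simp: Cb_x_def C_x_def)
next
  fix a b c
  assume "\<forall>t\<ge>0. \<forall>x. f x t = a * x \<and> g x t = b \<and> h x t = c * x"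
  then have "(\<lambda>y. h y t) = (\<lambda>y. c * y)"
    using \<open>0 \<le> t\<close> by auto
  then show ?thesis
    by simp
qed

lemma C_x_differentiable:
  assumes "C_x \<kappa> \<phi>" and "0 < \<kappa>" and "0 \<le> t"
  shows "(\<lambda>y. \<phi> y t) differentiable (at x)"
proof -
  have "((deriv ^^ 0) (\<lambda>y. \<phi> y t)) differentiable (at x)"
    using assms unfolding C_x_def by blast
  then show ?thesis
    by simp
qed

lemma C_x_deriv_differentiable:
  assumes "C_x \<kappa> \<phi>" and "1 < \<kappa>" and "0 \<le> t"
  shows "deriv (\<lambda>y. \<phi> y t) differentiable (at x)"
proof -
  have "((deriv ^^ 1) (\<lambda>y. \<phi> y t)) differentiable (at x)"
    using assms unfolding C_x_def by blast
  then show ?thesis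
    by simp
qed

lemma differentiable_imp_has_deriv:
  fixes \<phi> :: "real \<Rightarrow> real"
  assumes "\<phi> differentiable (at x)"
  shows "(\<phi> has_real_derivative deriv \<phi> x) (at x)"
  using assms by (simp add: DERIV_deriv_iff_real_differentiable)

text \<open>
  The rate \<open>r\<close> plays the role of \<open>h - \<hat>h - \<epsilon>\<close> at a fixed time. Grouping \<open>k\<^sup>2 p\<close> as \<open>k\<close> times the flux
  \<open>k p\<close> lets the product rule act without a derivative of \<open>p\<close>, and the factor \<open>k\<close> left over restores
  the flux.
\<close>

lemma deriv_scaled_square_flux:
  fixes k p r :: "real \<Rightarrow> real" and c x :: real
  assumes k: "k differentiable (at x)"
    and flux: "((\<lambda>y. k y * p y) has_real_derivative - r x * p x) (at x)"
  shows "((\<lambda>y. c * (k y)\<^sup>2 * p y) has_real_derivative c * (deriv k x - r x) * (k x * p x)) (at x)"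
proof -
  have "((\<lambda>y. c * (k y * (k y * p y))) has_real_derivative
      c * (k x * (- r x * p x) + deriv k x * (k x * p x))) (at x)"
    by (intro DERIV_cmult DERIV_mult' flux differentiable_imp_has_deriv k)
  then show ?thesis
    by (simp add: power2_eq_square algebra_simps)
qed

text \<open>
  The parameters \<open>\<theta>\<^sub>1\<close>, \<open>\<theta>\<^sub>2\<close> solve a linear system: comparing the coefficients of \<open>h\<close> gives
  \<open>\<theta>\<^sub>1 = (1 - \<beta>) (1 - \<eta>) + 2 \<eta>\<close>, and setting \<open>h = \<hat>h\<close> gives \<open>\<theta>\<^sub>1 + \<theta>\<^sub>2 = 2 (1 - \<alpha>)\<close>. Here \<open>e\<close> stands for \<open>\<epsilon>'\<close> and \<open>d\<close> for
  \<open>\<partial>k/\<partial>x\<close>.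
\<close>

lemma flux_balance:
  fixes \<alpha> \<beta> \<eta> h H e d :: real
  defines "\<theta>1 \<equiv> 1 - \<beta> + \<eta> + \<beta> * \<eta>" and "\<theta>2 \<equiv> 1 + \<beta> - \<eta> - \<beta> * \<eta> - 2 * \<alpha>"
  shows "1/2 * ((1 - \<beta>) * (d - (h - H - (\<eta> * (h - H) + e))))
    - (\<eta> * (h - H) + e - 1/2 * (\<theta>1 * h + \<theta>2 * H + (1 + \<beta>) * e - (1 - \<beta>) * d))
    = (1 - \<alpha>) * H"
  unfolding \<theta>1_def \<theta>2_def by (simp add: field_simps)

text \<open>
  The whole argument at one outcome and one time, with \<open>H\<close> for the filter mean. \<open>A\<close> and \<open>D\<close> stand for
  \<open>k\<^sup>2 + v\<^sup>2 - g\<^sup>2\<close> and \<open>u + k \<epsilon> + v \<zeta> - f\<close>, in the form they take once the class fixes \<open>v\<^sup>2\<close> and \<open>u\<close>.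
\<close>

lemma class_solves_spatial_equation:
  fixes k p h \<epsilon> e A D \<gamma> :: "real \<Rightarrow> real" and \<alpha> \<beta> \<eta> H :: real
  defines "\<theta>1 \<equiv> 1 - \<beta> + \<eta> + \<beta> * \<eta>" and "\<theta>2 \<equiv> 1 + \<beta> - \<eta> - \<beta> * \<eta> - 2 * \<alpha>"
  assumes k: "\<And>x. k differentiable (at x)"
    and dk: "\<And>x. deriv k differentiable (at x)"
    and h: "\<And>x. h differentiable (at x)"
    and diff_\<epsilon>: "\<And>x. \<epsilon> differentiable (at x)"
    and kp: "\<And>x. (\<lambda>y. k y * p y) differentiable (at x)"
    and constraint: "\<And>x. deriv (\<lambda>y. k y * p y) x + (h x - H - \<epsilon> x) * p x = 0"
    and \<epsilon>: "\<And>x. \<epsilon> x = \<eta> * (h x - H) + e x"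
    and \<gamma>: "\<And>x. \<gamma> x = - (\<alpha> + \<eta> - \<alpha> * \<eta>) * (h x - H) * H - (1 - \<alpha>) * e x * H"
    and A: "\<And>x. A x = (1 - \<beta>) * (k x)\<^sup>2"
    and D: "\<And>x. D x = k x * (\<epsilon> x
      - 1/2 * (\<theta>1 * h x + \<theta>2 * H + (1 + \<beta>) * e x - (1 - \<beta>) * deriv k x))"
  shows "(\<lambda>y. A y * p y) differentiable (at x) \<and>
    deriv (\<lambda>y. A y * p y) differentiable (at x) \<and>
    (\<lambda>y. D y * p y) differentiable (at x) \<and>
    1/2 * deriv (deriv (\<lambda>y. A y * p y)) x - deriv (\<lambda>y. D y * p y) x
      + ((h x - H) * H + \<gamma> x) * p x = 0"
proof -
  let ?Q = "\<lambda>y. k y * p y"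
  have flux: "(?Q has_real_derivative - (h y - H - \<epsilon> y) * p y) (at y)" for y
  proof -
    have "deriv ?Q y = - (h y - H - \<epsilon> y) * p y"
      using constraint[of y] by (simp add: algebra_simps)
    then show ?thesis
      using differentiable_imp_has_deriv[OF kp, of y] by simp
  qed
  have dA: "((\<lambda>y. A y * p y) has_real_derivative
      (1 - \<beta>) * (deriv k y - (h y - H - \<epsilon> y)) * ?Q y) (at y)" for y
    unfolding A using deriv_scaled_square_flux[where r = "\<lambda>y. h y - H - \<epsilon> y", OF k flux]
    by (simp only: mult.assoc)
  then have deriv_A: "deriv (\<lambda>y. A y * p y)
      = (\<lambda>y. (1 - \<beta>) * (deriv k y - (h y - H - \<epsilon> y)) * ?Q y)"
    by (intro ext DERIV_imp_deriv)
  have diff_dA: "deriv (\<lambda>y. A y * p y) differentiable (at x)"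
    unfolding deriv_A by (intro derivative_intros dk h diff_\<epsilon> kp)
  have balance: "1/2 * deriv (\<lambda>y. A y * p y) y - D y * p y = (1 - \<alpha>) * H * ?Q y" for y
  proof -
    have "1/2 * deriv (\<lambda>y. A y * p y) y - D y * p y
        = (1/2 * ((1 - \<beta>) * (deriv k y - (h y - H - \<epsilon> y)))
           - (\<epsilon> y - 1/2 * (\<theta>1 * h y + \<theta>2 * H + (1 + \<beta>) * e y - (1 - \<beta>) * deriv k y))) * ?Q y"
      unfolding deriv_A D by (simp add: algebra_simps)
    also have "\<dots> = (1 - \<alpha>) * H * ?Q y"
      unfolding \<epsilon> \<theta>1_def \<theta>2_def flux_balance ..
    finally show ?thesis .
  qed
  \<comment> \<open>Solving the balance for \<open>D p\<close> gives both its differentiability and its derivative.\<close>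
  have "(\<lambda>y. D y * p y) = (\<lambda>y. 1/2 * deriv (\<lambda>y. A y * p y) y - (1 - \<alpha>) * H * ?Q y)"
    using balance by (intro ext) (simp add: algebra_simps)
  moreover have "((\<lambda>y. 1/2 * deriv (\<lambda>y. A y * p y) y - (1 - \<alpha>) * H * ?Q y) has_real_derivative
      1/2 * deriv (deriv (\<lambda>y. A y * p y)) x - (1 - \<alpha>) * H * (- (h x - H - \<epsilon> x) * p x)) (at x)"
    by (intro DERIV_diff DERIV_cmult flux differentiable_imp_has_deriv diff_dA)
  ultimately have dD: "((\<lambda>y. D y * p y) has_real_derivative
      1/2 * deriv (deriv (\<lambda>y. A y * p y)) x - (1 - \<alpha>) * H * (- (h x - H - \<epsilon> x) * p x)) (at x)"
    by (simp only:)
  have "1/2 * deriv (deriv (\<lambda>y. A y * p y)) x - deriv (\<lambda>y. D y * p y) x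
      + ((h x - H) * H + \<gamma> x) * p x = 0"
    unfolding DERIV_imp_deriv[OF dD] \<gamma> \<epsilon> by (simp add: algebra_simps)
  then show ?thesis
    using dA diff_dA dD real_differentiable_def by blast
qed

theorem proposition5:
  fixes M :: "'a measure" and F :: "real \<Rightarrow> 'a measure"
    and f g h :: "real \<Rightarrow> real \<Rightarrow> real"
    and P0 :: "real measure" and p0 :: "real \<Rightarrow> real"
    and BX BY X Y B S W :: "real \<Rightarrow> 'a \<Rightarrow> real"
    and P :: "real \<Rightarrow> 'a \<Rightarrow> real measure"
    and p u k v \<gamma> \<epsilon> \<zeta> \<epsilon>' :: "'a \<Rightarrow> real \<Rightarrow> real \<Rightarrow> real"
    and \<alpha> \<beta> \<eta> \<theta>1 \<theta>2 :: "real \<Rightarrow> real"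
    and hhat :: "real \<Rightarrow> 'a \<Rightarrow> real"
  assumes hhat: "hhat = filter_mean h p"
    and \<theta>1: "\<theta>1 = (\<lambda>t. 1 - \<beta> t + \<eta> t + \<beta> t * \<eta> t)"
    and \<theta>2: "\<theta>2 = (\<lambda>t. 1 + \<beta> t - \<eta> t - \<beta> t * \<eta> t - 2 * \<alpha> t)"
    and system: "particle_system M F f g h P0 p0 BX BY X Y P p B S W u k v \<gamma> \<epsilon> \<zeta>"
    and constraint: "AE \<omega> in M. \<forall>t\<ge>0. \<forall>x.
      (\<lambda>y. k \<omega> y t * p \<omega> y t) differentiable (at x) \<and>
      deriv (\<lambda>y. k \<omega> y t * p \<omega> y t) x + (h x t - hhat t \<omega> - \<epsilon> \<omega> x t) * p \<omega> x t = 0"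
    and \<alpha>_cont: "continuous_on {0..} \<alpha>"
    and \<beta>_cont: "continuous_on {0..} \<beta>"
    and \<eta>_cont: "continuous_on {0..} \<eta>"
    and \<epsilon>'_regular: "observable_C_x M Y 1 \<epsilon>'"
    and \<epsilon>'_zero_mean: "AE \<omega> in M. \<forall>t\<ge>0.
      has_bochner_integral lborel (\<lambda>x. \<epsilon>' \<omega> x t * p \<omega> x t) 0"
    and \<epsilon>_class: "AE \<omega> in M. \<forall>t\<ge>0. \<forall>x.
      \<epsilon> \<omega> x t = \<eta> t * (h x t - hhat t \<omega>) + \<epsilon>' \<omega> x t"
    and \<gamma>_class: "AE \<omega> in M. \<forall>t\<ge>0. \<forall>x.
      \<gamma> \<omega> x t = - (\<alpha> t + \<eta> t - \<alpha> t * \<eta> t) * (h x t - hhat t \<omega>) * hhat t \<omega>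
               - (1 - \<alpha> t) * \<epsilon>' \<omega> x t * hhat t \<omega>"
    and v_class: "AE \<omega> in M. \<forall>t\<ge>0. \<forall>x.
      (v \<omega> x t)\<^sup>2 = (g x t)\<^sup>2 - \<beta> t * (k \<omega> x t)\<^sup>2"
    and u_class: "AE \<omega> in M. \<forall>t\<ge>0. \<forall>x.
      u \<omega> x t = f x t
        - 1/2 * k \<omega> x t * (\<theta>1 t * h x t + \<theta>2 t * hhat t \<omega> + (1 + \<beta> t) * \<epsilon>' \<omega> x t
                            - (1 - \<beta> t) * deriv (\<lambda>y. k \<omega> y t) x)
        - v \<omega> x t * \<zeta> \<omega> x t"
  shows "AE \<omega> in M. \<forall>t\<ge>0. \<forall>x.
      (\<lambda>y. ((k \<omega> y t)\<^sup>2 + (v \<omega> y t)\<^sup>2 - (g y t)\<^sup>2) * p \<omega> y t) differentiable (at x) \<and>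
      deriv (\<lambda>y. ((k \<omega> y t)\<^sup>2 + (v \<omega> y t)\<^sup>2 - (g y t)\<^sup>2) * p \<omega> y t) differentiable (at x) \<and>
      (\<lambda>y. (u \<omega> y t + k \<omega> y t * \<epsilon> \<omega> y t + v \<omega> y t * \<zeta> \<omega> y t - f y t) * p \<omega> y t)
        differentiable (at x) \<and>
      1/2 * deriv (deriv (\<lambda>y. ((k \<omega> y t)\<^sup>2 + (v \<omega> y t)\<^sup>2 - (g y t)\<^sup>2) * p \<omega> y t)) x
      - deriv (\<lambda>y. (u \<omega> y t + k \<omega> y t * \<epsilon> \<omega> y t + v \<omega> y t * \<zeta> \<omega> y t - f y t) * p \<omega> y t) x
      + ((h x t - hhat t \<omega>) * hhat t \<omega> + \<gamma> \<omega> x t) * p \<omega> x t = 0"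
proof -
  interpret particle_system M F f g h P0 p0 BX BY X Y P p B S W u k v \<gamma> \<epsilon> \<zeta>
    by (rule system)
  have k_C2: "AE \<omega> in M. C_x 2 (k \<omega>)" and \<epsilon>_C1: "AE \<omega> in M. C_x 1 (\<epsilon> \<omega>)"
    using k_regular \<epsilon>_regular by (auto simp: observable_C_x_def)
  show ?thesis
    using k_C2 \<epsilon>_C1 constraint \<epsilon>_class \<gamma>_class v_class u_class
  proof (eventually_elim, intro allI impI)
    fix \<omega> and t x :: real
    assume k: "C_x 2 (k \<omega>)" and \<epsilon>: "C_x 1 (\<epsilon> \<omega>)"
      and con: "\<forall>t\<ge>0. \<forall>x. (\<lambda>y. k \<omega> y t * p \<omega> y t) differentiable (at x) \<and>
        deriv (\<lambda>y. k \<omega> y t * p \<omega> y t) x + (h x t - hhat t \<omega> - \<epsilon> \<omega> x t) * p \<omega> x t = 0"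
      and \<epsilon>_eq: "\<forall>t\<ge>0. \<forall>x. \<epsilon> \<omega> x t = \<eta> t * (h x t - hhat t \<omega>) + \<epsilon>' \<omega> x t"
      and \<gamma>_eq: "\<forall>t\<ge>0. \<forall>x. \<gamma> \<omega> x t =
        - (\<alpha> t + \<eta> t - \<alpha> t * \<eta> t) * (h x t - hhat t \<omega>) * hhat t \<omega>
        - (1 - \<alpha> t) * \<epsilon>' \<omega> x t * hhat t \<omega>"
      and v_eq: "\<forall>t\<ge>0. \<forall>x. (v \<omega> x t)\<^sup>2 = (g x t)\<^sup>2 - \<beta> t * (k \<omega> x t)\<^sup>2"
      and u_eq: "\<forall>t\<ge>0. \<forall>x. u \<omega> x t = f x t
        - 1/2 * k \<omega> x t * (\<theta>1 t * h x t + \<theta>2 t * hhat t \<omega> + (1 + \<beta> t) * \<epsilon>' \<omega> x t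
                            - (1 - \<beta> t) * deriv (\<lambda>y. k \<omega> y t) x)
        - v \<omega> x t * \<zeta> \<omega> x t"
      and t: "0 \<le> t"
    note at_t = con[rule_format, OF t] \<epsilon>_eq[rule_format, OF t] \<gamma>_eq[rule_format, OF t]
      v_eq[rule_format, OF t] u_eq[rule_format, OF t]
    show "(\<lambda>y. ((k \<omega> y t)\<^sup>2 + (v \<omega> y t)\<^sup>2 - (g y t)\<^sup>2) * p \<omega> y t) differentiable (at x) \<and>
      deriv (\<lambda>y. ((k \<omega> y t)\<^sup>2 + (v \<omega> y t)\<^sup>2 - (g y t)\<^sup>2) * p \<omega> y t) differentiable (at x) \<and>
      (\<lambda>y. (u \<omega> y t + k \<omega> y t * \<epsilon> \<omega> y t + v \<omega> y t * \<zeta> \<omega> y t - f y t) * p \<omega> y t)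
        differentiable (at x) \<and>
      1/2 * deriv (deriv (\<lambda>y. ((k \<omega> y t)\<^sup>2 + (v \<omega> y t)\<^sup>2 - (g y t)\<^sup>2) * p \<omega> y t)) x
      - deriv (\<lambda>y. (u \<omega> y t + k \<omega> y t * \<epsilon> \<omega> y t + v \<omega> y t * \<zeta> \<omega> y t - f y t) * p \<omega> y t) x
      + ((h x t - hhat t \<omega>) * hhat t \<omega> + \<gamma> \<omega> x t) * p \<omega> x t = 0"
    proof (rule class_solves_spatial_equation[where k = "\<lambda>y. k \<omega> y t" and h = "\<lambda>y. h y t"
          and \<epsilon> = "\<lambda>y. \<epsilon> \<omega> y t" and e = "\<lambda>y. \<epsilon>' \<omega> y t" and \<gamma> = "\<lambda>y. \<gamma> \<omega> y t"
          and \<alpha> = "\<alpha> t" and \<beta> = "\<beta> t" and \<eta> = "\<eta> t" and H = "hhat t \<omega>"])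
      fix y
      show "(\<lambda>y. k \<omega> y t) differentiable (at y)"
        by (rule C_x_differentiable[OF k _ t]) simp
      show "deriv (\<lambda>y. k \<omega> y t) differentiable (at y)"
        by (rule C_x_deriv_differentiable[OF k _ t]) simp
      show "(\<lambda>y. h y t) differentiable (at y)"
        by (rule standing_conditions_h_differentiable[OF standing t])
      show "(\<lambda>y. \<epsilon> \<omega> y t) differentiable (at y)"
        by (rule C_x_differentiable[OF \<epsilon> _ t]) simp
      show "(k \<omega> y t)\<^sup>2 + (v \<omega> y t)\<^sup>2 - (g y t)\<^sup>2 = (1 - \<beta> t) * (k \<omega> y t)\<^sup>2"
        using at_t(4)[of y] by (simp add: algebra_simps)
      show "u \<omega> y t + k \<omega> y t * \<epsilon> \<omega> y t + v \<omega> y t * \<zeta> \<omega> y t - f y t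
        = k \<omega> y t * (\<epsilon> \<omega> y t - 1/2 * ((1 - \<beta> t + \<eta> t + \<beta> t * \<eta> t) * h y t
            + (1 + \<beta> t - \<eta> t - \<beta> t * \<eta> t - 2 * \<alpha> t) * hhat t \<omega>
            + (1 + \<beta> t) * \<epsilon>' \<omega> y t - (1 - \<beta> t) * deriv (\<lambda>y. k \<omega> y t) y))"
        unfolding at_t(5)[of y] \<theta>1 \<theta>2 by (simp add: algebra_simps)
    qed (use at_t in blast)+
  qed
qed

end
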